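(* Let $V$ be a complex Hilbert space. If $g\in\mathrm{Sp}(V)$ then the rule $\Phi=U1$ sets up a bijective correspondence between the set of all generalized Fock vacua $\Phi\in SV'$ for $g$ and the set of all generalized Fock implementers $U:SV\to SV'$ for $g$.
   Context: $V$ is a complex Hilbert space with inner product $\langle\cdot|\cdot\rangle$ (antilinear in the first slot, linear in the second) and complex structure $J=i\,\cdot$. $SV=\bigoplus_{d\ge0}S^dV$ is the (algebraic) symmetric algebra, with unit $1\in S^0V=\mathbb C$. $SV'$ is the space of all antilinear functionals $SV\to\mathbb C$ (no boundedness required). Creators and annihilators: for $v\in V$, $c(v):SV\to SV$ is multiplication by $v$, and $a(v):SV\to SV$ is the unique linear derivation with $a(v)1=0$ and $a(v)w=\langle v|w\rangle$ for $w\in V$. They extend to $SV'$ by $[c(v)\Phi](\psi)=\Phi(a(v)\psi)$ and $[a(v)\Phi](\psi)=\Phi(c(v)\psi)$ for $\Phi\in SV'$, $\psi\in SV$. On $SV$ and on $SV'$ put $\pi(v)=\frac1{\sqrt2}\{c(v)+a(v)\}$. $\Omega=\mathrm{Im}\langle\cdot|\cdot\rangle$; $\mathrm{Sp}(V)$ is the group of real-linear automorphisms $g$ of $V$ with $\Omega(gx,gy)=\Omega(x,y)$ for all $x,y\in V$. A generalized Fock implementer for $g$ is a nonzero linear map $U:SV\to SV'$ such that $U\pi(v)=\pi(gv)U$ for all $v\in V$ (with $\pi(v)$ acting on $SV$ and $\pi(gv)$ on $SV'$). A generalized Fock vacuum for $g$ is a nonzero $\Phi\in SV'$ such that $\{\pi(gv)+i\pi(gJv)\}\Phi=0$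 for all $v\in V$. *)

theory Defs
  imports "HOL-Analysis.Analysis" "HOL-Library.Poly_Mapping" "HOL-Library.Multiset"
begin

section \<open>Complex vector spaces and complex Hilbert spaces\<close>

class complex_vector = real_vector +
  fixes scaleC :: "complex \<Rightarrow> 'a \<Rightarrow> 'a" (infixr \<open>*\<^sub>C\<close> 75)
  assumes scaleC_add_right: "a *\<^sub>C (x + y) = a *\<^sub>C x + a *\<^sub>C y"
    and scaleC_add_left: "(a + b) *\<^sub>C x = a *\<^sub>C x + b *\<^sub>C x"
    and scaleC_scaleC: "a *\<^sub>C (b *\<^sub>C x) = (a * b) *\<^sub>C x"
    and scaleC_one: "1 *\<^sub>C x = x"
    and scaleR_scaleC: "r *\<^sub>R x = complex_of_real r *\<^sub>C x"

global_interpretation complex_vector: vector_space "scaleC :: complex \<Rightarrow> 'a \<Rightarrow> 'a::complex_vector"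
  by unfold_locales (simp_all add: scaleC_add_right scaleC_add_left scaleC_scaleC scaleC_one)

text \<open>The inner product is antilinear in the first slot and linear in the second;
  completeness is inherited from the class \<open>banach\<close>.\<close>

class complex_hilbert_space = complex_vector + banach +
  fixes cinner :: "'a \<Rightarrow> 'a \<Rightarrow> complex"
  assumes cinner_commute: "cinner x y = cnj (cinner y x)"
    and cinner_add_right: "cinner x (y + z) = cinner x y + cinner x z"
    and cinner_scaleC_right: "cinner x (a *\<^sub>C y) = a * cinner x y"
    and cinner_ge_zero: "0 \<le> Re (cinner x x)"
    and cinner_eq_zero_iff: "cinner x x = 0 \<longleftrightarrow> x = 0"
    and norm_eq_sqrt_cinner: "norm x = sqrt (Re (cinner x x))"

instantiation complex :: complex_hilbert_space
begin

definition scaleC_complex :: "complex \<Rightarrow> complex \<Rightarrow> complex" where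
  "scaleC_complex = (*)"

definition cinner_complex :: "complex \<Rightarrow> complex \<Rightarrow> complex" where
  "cinner_complex x y = cnj x * y"

instance
  by standard
    (auto simp: scaleC_complex_def cinner_complex_def scaleR_conv_of_real algebra_simps
      norm_complex_def power2_eq_square)

end

abbreviation clinear :: "('a::complex_vector \<Rightarrow> 'b::complex_vector) \<Rightarrow> bool" where
  "clinear \<equiv> Vector_Spaces.linear scaleC scaleC"

lemma clinear_iff:
  "clinear f \<longleftrightarrow> (\<forall>x y. f (x + y) = f x + f y) \<and> (\<forall>c x. f (c *\<^sub>C x) = c *\<^sub>C f x)"
  by (simp add: Vector_Spaces.linear_iff complex_vector.vector_space_axioms)

definition antilinear :: "('a::complex_vector \<Rightarrow> complex) \<Rightarrow> bool" where
  "antilinear \<Phi> \<longleftrightarrow> (\<forall>x y. \<Phi> (x + y) = \<Phi> x + \<Phi> y) \<and> (\<forall>c x. \<Phi> (c *\<^sub>C x) = cnj c * \<Phi> x)"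


section \<open>The symmetric algebra\<close>

text \<open>The finitely supported functions \<open>'v multiset \<Rightarrow>\<^sub>0 complex\<close> with the convolution product
  form the free commutative complex algebra (polynomial algebra) on the set of elements of \<open>V\<close>.
  The symmetric algebra is its quotient by the ideal that forces the generators to depend
  linearly on the vectors. The term \<open>Poly_Mapping.single 0 c\<close> is the scalar \<open>c\<close>.\<close>

type_synonym 'v free_alg = "'v multiset \<Rightarrow>\<^sub>0 complex"

definition free_gen :: "'v \<Rightarrow> 'v free_alg" where
  "free_gen v = Poly_Mapping.single {#v#} 1"

definition sym_rels :: "'v::complex_vector free_alg set" where
  "sym_rels = {free_gen (v + w) - free_gen v - free_gen w | v w. True}
     \<union> {free_gen (c *\<^sub>C v) - Poly_Mapping.single 0 c * free_gen v | c v. True}"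

text \<open>The span over the ring itself, that is, the ideal generated by the relations.\<close>

definition sym_ideal :: "'v::complex_vector free_alg set" where
  "sym_ideal = module.span (*) sym_rels"

interpretation free_mod: module "(*) :: 'v free_alg \<Rightarrow> 'v free_alg \<Rightarrow> 'v free_alg"
  by unfold_locales (simp_all add: algebra_simps)

lemma sym_ideal_add: "p \<in> sym_ideal \<Longrightarrow> q \<in> sym_ideal \<Longrightarrow> p + q \<in> sym_ideal"
  unfolding sym_ideal_def by (rule free_mod.span_add)

lemma sym_ideal_minus: "p \<in> sym_ideal \<Longrightarrow> - p \<in> sym_ideal"
  unfolding sym_ideal_def by (rule free_mod.span_neg)

lemma sym_ideal_mult: "p \<in> sym_ideal \<Longrightarrow> r * p \<in> sym_ideal"
  unfolding sym_ideal_def by (rule free_mod.span_scale)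

lemma sym_ideal_zero: "0 \<in> sym_ideal"
  unfolding sym_ideal_def by (rule free_mod.span_zero)

definition sym_rel :: "'v::complex_vector free_alg \<Rightarrow> 'v free_alg \<Rightarrow> bool" where
  "sym_rel p q \<longleftrightarrow> p - q \<in> sym_ideal"

lemma equivp_sym_rel: "equivp sym_rel"
proof (rule equivpI)
  show "reflp sym_rel" by (simp add: reflp_def sym_rel_def sym_ideal_zero)
  show "symp sym_rel" unfolding symp_def sym_rel_def
    using sym_ideal_minus by fastforce
  show "transp sym_rel" unfolding transp_def sym_rel_def
    using sym_ideal_add by fastforce
qed

quotient_type (overloaded) 'v sym_alg = "'v::complex_vector free_alg" / sym_rel
  by (rule equivp_sym_rel)

lemma free_alg_coeff0_mult:
  fixes p :: "'v free_alg"
  shows "Poly_Mapping.lookup (p * q) {#} = Poly_Mapping.lookup p {#} * Poly_Mapping.lookup q {#}"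
proof -
  have **: "(\<Sum>r. (Poly_Mapping.lookup q r when {#} = l + r))
      = (Poly_Mapping.lookup q {#} when l = {#})" for l
    by (cases "l = {#}") simp_all
  have "Poly_Mapping.lookup (p * q) {#}
      = (\<Sum>l. Poly_Mapping.lookup p l * (Poly_Mapping.lookup q {#} when l = {#}))"
    by (simp only: lookup_mult **)
  also have "\<dots> = Poly_Mapping.lookup p {#} * Poly_Mapping.lookup q {#}"
    by (simp add: mult_when)
  finally show ?thesis .
qed

lemma sym_ideal_coeff0:
  assumes "p \<in> sym_ideal" shows "Poly_Mapping.lookup p {#} = 0"
  using assms unfolding sym_ideal_def
proof (induction rule: free_mod.span_induct_alt)
  case base
  then show ?case by simp
next
  case (step c x y)
  have "Poly_Mapping.lookup x {#} = 0"
    using step(1)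
    by (auto simp: sym_rels_def free_gen_def lookup_minus lookup_single free_alg_coeff0_mult)
  then show ?case using step by (simp add: lookup_add free_alg_coeff0_mult)
qed

instantiation sym_alg :: (complex_vector) comm_ring_1
begin

lift_definition zero_sym_alg :: "'a sym_alg" is "0" .
lift_definition one_sym_alg :: "'a sym_alg" is "1" .

lift_definition plus_sym_alg :: "'a sym_alg \<Rightarrow> 'a sym_alg \<Rightarrow> 'a sym_alg" is "(+)"
  unfolding sym_rel_def
proof -
  fix a b c d :: "'a free_alg"
  assume "a - b \<in> sym_ideal" "c - d \<in> sym_ideal"
  then have "(a - b) + (c - d) \<in> sym_ideal" by (rule sym_ideal_add)
  then show "a + c - (b + d) \<in> sym_ideal" by (simp add: algebra_simps)
qed

lift_definition uminus_sym_alg :: "'a sym_alg \<Rightarrow> 'a sym_alg" is "uminus"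
  unfolding sym_rel_def
proof -
  fix a b :: "'a free_alg"
  assume "a - b \<in> sym_ideal"
  then have "- (a - b) \<in> sym_ideal" by (rule sym_ideal_minus)
  then show "- a - - b \<in> sym_ideal" by simp
qed

lift_definition minus_sym_alg :: "'a sym_alg \<Rightarrow> 'a sym_alg \<Rightarrow> 'a sym_alg" is "(-)"
  unfolding sym_rel_def
proof -
  fix a b c d :: "'a free_alg"
  assume "a - b \<in> sym_ideal" "c - d \<in> sym_ideal"
  then have "(a - b) + - (c - d) \<in> sym_ideal" by (intro sym_ideal_add sym_ideal_minus)
  then show "a - c - (b - d) \<in> sym_ideal" by (simp add: algebra_simps)
qed

lift_definition times_sym_alg :: "'a sym_alg \<Rightarrow> 'a sym_alg \<Rightarrow> 'a sym_alg" is "(*)"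
  unfolding sym_rel_def
proof -
  fix a b c d :: "'a free_alg"
  assume "a - b \<in> sym_ideal" "c - d \<in> sym_ideal"
  then have "c * (a - b) + b * (c - d) \<in> sym_ideal" by (intro sym_ideal_add sym_ideal_mult)
  then show "a * c - b * d \<in> sym_ideal" by (simp add: algebra_simps)
qed

instance
proof
  fix a b c :: "'a sym_alg"
  have eq: "x = y \<Longrightarrow> sym_rel x y" for x y :: "'a free_alg"
    by (simp add: sym_rel_def sym_ideal_zero)
  show "a + b + c = a + (b + c)" by transfer (rule eq, simp add: algebra_simps)
  show "a + b = b + a" by transfer (rule eq, simp add: algebra_simps)
  show "0 + a = a" by transfer (rule eq, simp add: algebra_simps)
  show "- a + a = 0" by transfer (rule eq, simp add: algebra_simps)
  show "a - b = a + - b" by transfer (rule eq, simp add: algebra_simps)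
  show "a * b * c = a * (b * c)" by transfer (rule eq, rule mult.assoc)
  show "a * b = b * a" by transfer (rule eq, rule mult.commute)
  show "1 * a = a" by transfer (rule eq, rule mult_1_left)
  show "(a + b) * c = a * c + b * c" by transfer (rule eq, rule distrib_right)
  show "(0::'a sym_alg) \<noteq> 1"
  proof (transfer, rule notI)
    assume "sym_rel (0::'a free_alg) 1"
    then have "Poly_Mapping.lookup (0 - 1 :: 'a free_alg) {#} = 0"
      unfolding sym_rel_def by (rule sym_ideal_coeff0)
    then show False by (simp add: lookup_minus lookup_one)
  qed
qed

end

instantiation sym_alg :: (complex_vector) complex_vector
begin

lift_definition scaleC_sym_alg :: "complex \<Rightarrow> 'a sym_alg \<Rightarrow> 'a sym_alg"
  is "\<lambda>c p. Poly_Mapping.single 0 c * p"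
  unfolding sym_rel_def
proof -
  fix c and p q :: "'a free_alg"
  assume "p - q \<in> sym_ideal"
  then have "Poly_Mapping.single 0 c * (p - q) \<in> sym_ideal" by (rule sym_ideal_mult)
  then show "Poly_Mapping.single 0 c * p - Poly_Mapping.single 0 c * q \<in> sym_ideal"
    by (simp add: right_diff_distrib)
qed

definition scaleR_sym_alg :: "real \<Rightarrow> 'a sym_alg \<Rightarrow> 'a sym_alg" where
  "scaleR_sym_alg r x = complex_of_real r *\<^sub>C x"

instance
proof
  fix a b :: complex and r s :: real and x y :: "'a sym_alg"
  have eq: "p = q \<Longrightarrow> sym_rel p q" for p q :: "'a free_alg"
    by (simp add: sym_rel_def sym_ideal_zero)
  show 1: "a *\<^sub>C (x + y) = a *\<^sub>C x + a *\<^sub>C y" for a and x y :: "'a sym_alg"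
    by transfer (rule eq, simp add: algebra_simps)
  show 2: "(a + b) *\<^sub>C x = a *\<^sub>C x + b *\<^sub>C x" for a b and x :: "'a sym_alg"
    by transfer (rule eq, simp add: single_add algebra_simps)
  show 3: "a *\<^sub>C (b *\<^sub>C x) = (a * b) *\<^sub>C x" for a b and x :: "'a sym_alg"
    by transfer (rule eq, simp add: mult_single flip: mult.assoc)
  show 4: "1 *\<^sub>C x = x" for x :: "'a sym_alg"
    by transfer (rule eq, simp)
  show "r *\<^sub>R x = complex_of_real r *\<^sub>C x" by (simp add: scaleR_sym_alg_def)
  show "r *\<^sub>R (x + y) = r *\<^sub>R x + r *\<^sub>R y" by (simp add: scaleR_sym_alg_def 1)
  show "(r + s) *\<^sub>R x = r *\<^sub>R x + s *\<^sub>R x" by (simp add: scaleR_sym_alg_def 2)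
  show "r *\<^sub>R s *\<^sub>R x = (r * s) *\<^sub>R x" by (simp add: scaleR_sym_alg_def 3)
  show "1 *\<^sub>R x = x" by (simp add: scaleR_sym_alg_def 4)
qed

end

lift_definition sym_gen :: "'v::complex_vector \<Rightarrow> 'v sym_alg" is free_gen .

lemma sym_gen_add: "sym_gen (v + w) = sym_gen v + sym_gen w"
proof (transfer, unfold sym_rel_def)
  fix v w :: "'v::complex_vector"
  have "free_gen (v + w) - free_gen v - free_gen w \<in> sym_ideal"
    unfolding sym_ideal_def by (rule free_mod.span_base) (auto simp: sym_rels_def)
  then show "free_gen (v + w) - (free_gen v + free_gen w) \<in> sym_ideal"
    by (simp add: algebra_simps)
qed

lemma sym_gen_scaleC: "sym_gen (c *\<^sub>C v) = c *\<^sub>C sym_gen v"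
proof (transfer, unfold sym_rel_def)
  fix c and v :: "'v::complex_vector"
  show "free_gen (c *\<^sub>C v) - Poly_Mapping.single 0 c * free_gen v \<in> sym_ideal"
    unfolding sym_ideal_def
    by (rule free_mod.span_base, unfold sym_rels_def, rule UnI2) blast
qed

lemma scaleC_mult_left: "c *\<^sub>C x * y = c *\<^sub>C (x * y)" for x y :: "'v::complex_vector sym_alg"
proof (transfer, unfold sym_rel_def)
  fix c and p q :: "'v free_alg"
  have "Poly_Mapping.single 0 c * p * q = Poly_Mapping.single 0 c * (p * q)"
    by (rule mult.assoc)
  then show "Poly_Mapping.single 0 c * p * q - Poly_Mapping.single 0 c * (p * q) \<in> sym_ideal"
    by (simp add: sym_ideal_zero)
qed

lemma scaleC_mult_right: "x * c *\<^sub>C y = c *\<^sub>C (x * y)" for x y :: "'v::complex_vector sym_alg"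
  by (metis scaleC_mult_left mult.commute)

lemma free_alg_induct [case_names zero one gen add scale]:
  fixes p :: "'v free_alg"
  assumes zero: "P 0" and one: "P 1" and gen: "\<And>v p. P p \<Longrightarrow> P (free_gen v * p)"
    and add: "\<And>p q. P p \<Longrightarrow> P q \<Longrightarrow> P (p + q)"
    and scale: "\<And>c p. P p \<Longrightarrow> P (Poly_Mapping.single 0 c * p)"
  shows "P p"
proof -
  have mon: "P (Poly_Mapping.single M 1)" for M
  proof (induction M)
    case empty
    then show ?case using one by simp
  next
    case (add v M)
    then show ?case using gen[of "Poly_Mapping.single M 1" v]
      by (simp add: free_gen_def mult_single)
  qed
  have single: "P (Poly_Mapping.single M c)" for M c
    using scale[OF mon[of M], of c] by (simp add: mult_single)
  show ?thesis
  proof (induction p rule: update_induct)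
    case const
    then show ?case by (rule zero)
  next
    case (update f M c)
    have "Poly_Mapping.update M c f = f + Poly_Mapping.single M c"
      using update(1)
      by (intro poly_mapping_eqI)
        (auto simp: lookup_update lookup_add lookup_single when_def in_keys_iff)
    then show ?case using add[OF update(3) single] by simp
  qed
qed

lemma sym_alg_induct [case_names one gen add scale]:
  fixes x :: "'v::complex_vector sym_alg"
  assumes one: "P 1" and gen: "\<And>v x. P x \<Longrightarrow> P (sym_gen v * x)"
    and add: "\<And>x y. P x \<Longrightarrow> P y \<Longrightarrow> P (x + y)"
    and scale: "\<And>c x. P x \<Longrightarrow> P (c *\<^sub>C x)"
  shows "P x"
proof -
  have "P (abs_sym_alg p)" for p
  proof (induction p rule: free_alg_induct)
    case zero
    then show ?case using scale[OF one, of 0]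
      by (simp add: zero_sym_alg_def[symmetric])
  next
    case one
    then show ?case using assms(1) by (simp add: one_sym_alg_def)
  next
    case (gen v p)
    then show ?case using assms(2)[of "abs_sym_alg p" v]
      by (simp add: sym_gen.abs_eq times_sym_alg.abs_eq)
  next
    case (add p q)
    then show ?case using assms(3)[of "abs_sym_alg p" "abs_sym_alg q"]
      by (simp add: plus_sym_alg.abs_eq)
  next
    case (scale c p)
    then show ?case using assms(4)[of "abs_sym_alg p" c]
      by (simp add: scaleC_sym_alg.abs_eq)
  qed
  then show ?thesis by (metis Quotient_abs_rep[OF Quotient_sym_alg])
qed


section \<open>Creators and annihilators on the symmetric algebra\<close>

definition creat_sym :: "'v::complex_vector \<Rightarrow> 'v sym_alg \<Rightarrow> 'v sym_alg" where
  "creat_sym v \<psi> = sym_gen v * \<psi>"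

definition linear_derivation :: "('v::complex_vector sym_alg \<Rightarrow> 'v sym_alg) \<Rightarrow> bool" where
  "linear_derivation D \<longleftrightarrow> clinear D \<and> (\<forall>x y. D (x * y) = D x * y + x * D y)"

definition is_annihilator ::
    "'v::complex_hilbert_space \<Rightarrow> ('v sym_alg \<Rightarrow> 'v sym_alg) \<Rightarrow> bool" where
  "is_annihilator v D \<longleftrightarrow>
     linear_derivation D \<and> D 1 = 0 \<and> (\<forall>w. D (sym_gen w) = cinner v w *\<^sub>C 1)"

definition annih_sym :: "'v::complex_hilbert_space \<Rightarrow> 'v sym_alg \<Rightarrow> 'v sym_alg" where
  "annih_sym v = (THE D. is_annihilator v D)"

lemma is_annihilator_unique:
  assumes "is_annihilator v D" "is_annihilator v D'"
  shows "D = D'"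
proof
  fix x
  show "D x = D' x"
    by (induction x rule: sym_alg_induct)
      (use assms in \<open>auto simp: is_annihilator_def linear_derivation_def clinear_iff\<close>)
qed

text \<open>Existence of the derivation: it is first defined on the free algebra, with values in
  the symmetric algebra.\<close>

definition free_deriv_mon :: "'v::complex_hilbert_space \<Rightarrow> 'v multiset \<Rightarrow> 'v sym_alg" where
  "free_deriv_mon v M =
     (\<Sum>w\<in>#M. cinner v w *\<^sub>C abs_sym_alg (Poly_Mapping.single (M - {#w#}) 1))"

definition free_deriv :: "'v::complex_hilbert_space \<Rightarrow> 'v free_alg \<Rightarrow> 'v sym_alg" where
  "free_deriv v p = (\<Sum>M\<in>Poly_Mapping.keys p. Poly_Mapping.lookup p M *\<^sub>C free_deriv_mon v M)"

lemma free_deriv_superset: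
  assumes "finite S" "Poly_Mapping.keys p \<subseteq> S"
  shows "free_deriv v p = (\<Sum>M\<in>S. Poly_Mapping.lookup p M *\<^sub>C free_deriv_mon v M)"
  unfolding free_deriv_def using assms
  by (intro sum.mono_neutral_left) (auto simp: in_keys_iff)

lemma free_deriv_add: "free_deriv v (p + q) = free_deriv v p + free_deriv v q"
proof -
  let ?S = "Poly_Mapping.keys p \<union> Poly_Mapping.keys q"
  have "Poly_Mapping.keys (p + q) \<subseteq> ?S" by (rule Poly_Mapping.keys_add)
  then show ?thesis
    by (simp add: free_deriv_superset[of ?S] lookup_add scaleC_add_left sum.distrib)
qed

lemma free_deriv_single: "free_deriv v (Poly_Mapping.single M c) = c *\<^sub>C free_deriv_mon v M"
  by (subst free_deriv_superset[of "{M}"]) auto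

lemma lookup_scalar_mult:
  "Poly_Mapping.lookup (Poly_Mapping.single 0 c * p :: 'v free_alg) M = c * Poly_Mapping.lookup p M"
  by (simp add: mult_map_scale_conv_mult[symmetric] map.rep_eq when_def)

lemma free_deriv_scale: "free_deriv v (Poly_Mapping.single 0 c * p) = c *\<^sub>C free_deriv v p"
proof -
  have "Poly_Mapping.keys (Poly_Mapping.single 0 c * p) \<subseteq> Poly_Mapping.keys p"
    by (auto simp: in_keys_iff lookup_scalar_mult)
  then show ?thesis
    by (simp add: free_deriv_superset[of "Poly_Mapping.keys p"] lookup_scalar_mult
        complex_vector.scale_sum_right)
qed

lemma free_deriv_zero: "free_deriv v 0 = 0"
  by (simp add: free_deriv_def)

lemma free_deriv_one: "free_deriv v 1 = 0"
  using free_deriv_single[of v 0 1] by (simp add: free_deriv_mon_def)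

lemma free_deriv_free_gen: "free_deriv v (free_gen w) = cinner v w *\<^sub>C 1"
  unfolding free_gen_def free_deriv_single free_deriv_mon_def
  by (simp add: one_sym_alg_def)

lemma free_deriv_mon_add_mset:
  "free_deriv_mon v (add_mset w M) =
     cinner v w *\<^sub>C abs_sym_alg (Poly_Mapping.single M 1) + sym_gen w * free_deriv_mon v M"
proof -
  have "(\<Sum>u\<in>#M. cinner v u *\<^sub>C abs_sym_alg (Poly_Mapping.single (add_mset w M - {#u#}) 1))
      = (\<Sum>u\<in>#M. sym_gen w * (cinner v u *\<^sub>C abs_sym_alg (Poly_Mapping.single (M - {#u#}) 1)))"
  proof (rule arg_cong[of _ _ sum_mset], rule image_mset_cong)
    fix u assume "u \<in># M"
    then have "add_mset w M - {#u#} = add_mset w (M - {#u#})"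
      by (rule diff_union_swap2)
    then show "cinner v u *\<^sub>C abs_sym_alg (Poly_Mapping.single (add_mset w M - {#u#}) 1) =
        sym_gen w * (cinner v u *\<^sub>C abs_sym_alg (Poly_Mapping.single (M - {#u#}) 1))"
      by (simp add: scaleC_mult_right sym_gen.abs_eq times_sym_alg.abs_eq free_gen_def mult_single)
  qed
  then show ?thesis
    by (simp add: free_deriv_mon_def sum_mset_distrib_left image_mset.compositionality o_def)
qed

lemma free_deriv_gen_mult:
  "free_deriv v (free_gen w * p) =
     cinner v w *\<^sub>C abs_sym_alg p + sym_gen w * free_deriv v p"
proof (induction p rule: update_induct)
  case const
  then show ?case by (simp add: free_deriv_zero zero_sym_alg_def[symmetric])
next
  case (update f M c)
  have s: "free_deriv v (free_gen w * Poly_Mapping.single M c) =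
     cinner v w *\<^sub>C abs_sym_alg (Poly_Mapping.single M c)
       + sym_gen w * free_deriv v (Poly_Mapping.single M c)"
  proof -
    have "abs_sym_alg (Poly_Mapping.single M c) = c *\<^sub>C abs_sym_alg (Poly_Mapping.single M 1)"
      by (simp add: scaleC_sym_alg.abs_eq mult_single)
    then show ?thesis
      by (simp add: free_gen_def mult_single free_deriv_single free_deriv_mon_add_mset
          scaleC_add_right scaleC_mult_right scaleC_scaleC mult.commute)
  qed
  have "Poly_Mapping.update M c f = f + Poly_Mapping.single M c"
    using update(1)
    by (intro poly_mapping_eqI)
      (auto simp: lookup_update lookup_add lookup_single when_def in_keys_iff)
  then show ?case
    using update(3) s
    by (simp add: free_deriv_add distrib_left plus_sym_alg.abs_eq[symmetric] scaleC_add_right)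
qed

lemma free_deriv_mult:
  "free_deriv v (p * q) = free_deriv v p * abs_sym_alg q + abs_sym_alg p * free_deriv v q"
proof (induction p rule: free_alg_induct)
  case zero
  then show ?case by (simp add: free_deriv_zero zero_sym_alg_def[symmetric])
next
  case one
  then show ?case by (simp add: free_deriv_one one_sym_alg_def[symmetric])
next
  case (gen w p)
  have abs: "abs_sym_alg (free_gen w * p) = sym_gen w * abs_sym_alg p"
    by (simp add: sym_gen.abs_eq times_sym_alg.abs_eq)
  have "free_deriv v (free_gen w * p * q) = free_deriv v (free_gen w * (p * q))"
    by (rule arg_cong[OF mult.assoc])
  also have "\<dots> = cinner v w *\<^sub>C (abs_sym_alg p * abs_sym_alg q)
      + sym_gen w * (free_deriv v p * abs_sym_alg q + abs_sym_alg p * free_deriv v q)"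
    by (simp only: free_deriv_gen_mult gen.IH times_sym_alg.abs_eq)
  also have "\<dots> = free_deriv v (free_gen w * p) * abs_sym_alg q
      + abs_sym_alg (free_gen w * p) * free_deriv v q"
    by (simp only: free_deriv_gen_mult abs distrib_right distrib_left scaleC_mult_left
        mult.assoc add.assoc)
  finally show ?case .
next
  case (add p p')
  then show ?case
    by (simp add: distrib_right free_deriv_add plus_sym_alg.abs_eq[symmetric])
next
  case (scale c p)
  have abs: "abs_sym_alg (Poly_Mapping.single 0 c * p) = c *\<^sub>C abs_sym_alg p"
    by (simp add: scaleC_sym_alg.abs_eq)
  have "free_deriv v (Poly_Mapping.single 0 c * p * q)
      = free_deriv v (Poly_Mapping.single 0 c * (p * q))"
    by (rule arg_cong[OF mult.assoc])
  also have "\<dots> = free_deriv v (Poly_Mapping.single 0 c * p) * abs_sym_alg q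
      + abs_sym_alg (Poly_Mapping.single 0 c * p) * free_deriv v q"
    by (simp only: free_deriv_scale scale.IH abs scaleC_mult_left scaleC_add_right)
  finally show ?case .
qed

lemma free_deriv_uminus: "free_deriv v (- p) = - free_deriv v p"
  using free_deriv_add[of v p "- p"] by (simp add: free_deriv_zero eq_neg_iff_add_eq_0 add.commute)

lemma free_deriv_diff: "free_deriv v (p - q) = free_deriv v p - free_deriv v q"
  using free_deriv_add[of v p "- q"] by (simp add: free_deriv_uminus)

lemma abs_sym_alg_eq_iff: "abs_sym_alg p = abs_sym_alg q \<longleftrightarrow> p - q \<in> sym_ideal"
  by (simp add: sym_alg.abs_eq_iff sym_rel_def)

lemma free_deriv_sym_ideal:
  assumes "p \<in> sym_ideal" shows "free_deriv v p = 0"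
  using assms unfolding sym_ideal_def
proof (induction rule: free_mod.span_induct_alt)
  case base
  then show ?case by (rule free_deriv_zero)
next
  case (step c x y)
  have "x \<in> sym_ideal"
    unfolding sym_ideal_def using step(1) by (rule free_mod.span_base)
  then have "abs_sym_alg x = 0"
    by (simp add: zero_sym_alg_def abs_sym_alg_eq_iff)
  moreover have "free_deriv v x = 0"
    using step(1)
    by (auto simp: sym_rels_def free_deriv_diff free_deriv_scale free_deriv_free_gen
        cinner_add_right cinner_scaleC_right scaleC_add_left scaleC_scaleC)
  ultimately show ?case
    using step by (simp add: free_deriv_add free_deriv_mult)
qed

lemma is_annihilator_exists:
  fixes v :: "'v::complex_hilbert_space"
  shows "\<exists>D. is_annihilator v D"
proof -
  define D where "D = (\<lambda>x. free_deriv v (rep_sym_alg x))"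
  have D: "D (abs_sym_alg p) = free_deriv v p" for p
  proof -
    have "abs_sym_alg (rep_sym_alg (abs_sym_alg p)) = abs_sym_alg p"
      by (rule Quotient_abs_rep[OF Quotient_sym_alg])
    then have "free_deriv v (rep_sym_alg (abs_sym_alg p) - p) = 0"
      by (simp add: abs_sym_alg_eq_iff free_deriv_sym_ideal)
    then show ?thesis by (simp add: D_def free_deriv_diff)
  qed
  have ex: "\<exists>p. x = abs_sym_alg p" for x :: "'v sym_alg"
    by (metis Quotient_abs_rep[OF Quotient_sym_alg])
  have "D (x + y) = D x + D y" for x y
    using ex[of x] ex[of y] by (auto simp: plus_sym_alg.abs_eq D free_deriv_add)
  moreover have "D (c *\<^sub>C x) = c *\<^sub>C D x" for c x
    using ex[of x] by (auto simp: scaleC_sym_alg.abs_eq D free_deriv_scale)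
  moreover have "D (x * y) = D x * y + x * D y" for x y
    using ex[of x] ex[of y] by (auto simp: times_sym_alg.abs_eq D free_deriv_mult)
  moreover have "D 1 = 0"
    by (simp add: one_sym_alg_def D free_deriv_one)
  moreover have "D (sym_gen w) = cinner v w *\<^sub>C 1" for w
    by (simp add: sym_gen.abs_eq D free_deriv_free_gen)
  ultimately have "is_annihilator v D"
    by (auto simp: is_annihilator_def linear_derivation_def clinear_iff)
  then show ?thesis by blast
qed

theorem ex1_annihilator: "\<exists>!D. is_annihilator v D"
  for v :: "'v::complex_hilbert_space"
  using is_annihilator_exists is_annihilator_unique by blast

theorem is_annihilator_annih_sym: "is_annihilator v (annih_sym v)"
  unfolding annih_sym_def by (rule theI'[OF ex1_annihilator])

lemma annih_sym_add: "annih_sym v (x + y) = annih_sym v x + annih_sym v y"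
  and annih_sym_scaleC: "annih_sym v (c *\<^sub>C x) = c *\<^sub>C annih_sym v x"
  and annih_sym_mult: "annih_sym v (x * y) = annih_sym v x * y + x * annih_sym v y"
  and annih_sym_one: "annih_sym v 1 = 0"
  and annih_sym_gen: "annih_sym v (sym_gen w) = cinner v w *\<^sub>C 1"
  using is_annihilator_annih_sym[of v]
  by (simp_all add: is_annihilator_def linear_derivation_def clinear_iff)


section \<open>The full antidual and the extended operators\<close>

typedef (overloaded) 'v sym_antidual = "{\<Phi> :: 'v::complex_vector sym_alg \<Rightarrow> complex. antilinear \<Phi>}"
  morphisms antidual_apply Abs_sym_antidual
  by (rule exI[of _ "\<lambda>_. 0"]) (simp add: antilinear_def)

setup_lifting type_definition_sym_antidual

instantiation sym_antidual :: (complex_vector) complex_vector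
begin

lift_definition zero_sym_antidual :: "'a sym_antidual" is "\<lambda>_. 0"
  by (simp add: antilinear_def)
lift_definition plus_sym_antidual :: "'a sym_antidual \<Rightarrow> 'a sym_antidual \<Rightarrow> 'a sym_antidual"
  is "\<lambda>\<Phi> \<Psi> \<psi>. \<Phi> \<psi> + \<Psi> \<psi>"
  by (simp add: antilinear_def algebra_simps)
lift_definition uminus_sym_antidual :: "'a sym_antidual \<Rightarrow> 'a sym_antidual"
  is "\<lambda>\<Phi> \<psi>. - \<Phi> \<psi>"
  by (simp add: antilinear_def)
lift_definition minus_sym_antidual :: "'a sym_antidual \<Rightarrow> 'a sym_antidual \<Rightarrow> 'a sym_antidual"
  is "\<lambda>\<Phi> \<Psi> \<psi>. \<Phi> \<psi> - \<Psi> \<psi>"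
  by (simp add: antilinear_def algebra_simps)
lift_definition scaleC_sym_antidual :: "complex \<Rightarrow> 'a sym_antidual \<Rightarrow> 'a sym_antidual"
  is "\<lambda>c \<Phi> \<psi>. c * \<Phi> \<psi>"
  by (simp add: antilinear_def algebra_simps)
lift_definition scaleR_sym_antidual :: "real \<Rightarrow> 'a sym_antidual \<Rightarrow> 'a sym_antidual"
  is "\<lambda>r \<Phi> \<psi>. complex_of_real r * \<Phi> \<psi>"
  by (simp add: antilinear_def algebra_simps)

instance
  by standard (transfer; simp add: fun_eq_iff algebra_simps)+

end

lift_definition creat_dual ::
    "'v::complex_hilbert_space \<Rightarrow> 'v sym_antidual \<Rightarrow> 'v sym_antidual"
  is "\<lambda>v \<Phi> \<psi>. \<Phi> (annih_sym v \<psi>)"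
  by (simp add: antilinear_def annih_sym_add annih_sym_scaleC)

lift_definition annih_dual ::
    "'v::complex_hilbert_space \<Rightarrow> 'v sym_antidual \<Rightarrow> 'v sym_antidual"
  is "\<lambda>v \<Phi> \<psi>. \<Phi> (creat_sym v \<psi>)"
  by (auto simp: antilinear_def creat_sym_def distrib_left scaleC_mult_right)

definition pi_sym :: "'v::complex_hilbert_space \<Rightarrow> 'v sym_alg \<Rightarrow> 'v sym_alg" where
  "pi_sym v \<psi> = (1 / sqrt 2) *\<^sub>R (creat_sym v \<psi> + annih_sym v \<psi>)"

definition pi_dual :: "'v::complex_hilbert_space \<Rightarrow> 'v sym_antidual \<Rightarrow> 'v sym_antidual" where
  "pi_dual v \<Phi> = (1 / sqrt 2) *\<^sub>R (creat_dual v \<Phi> + annih_dual v \<Phi>)"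


section \<open>Symplectic automorphisms, generalized Fock implementers and vacua\<close>

definition symp_form :: "'v::complex_hilbert_space \<Rightarrow> 'v \<Rightarrow> real" where
  "symp_form x y = Im (cinner x y)"

text \<open>No boundedness is required: \<open>linear\<close> is plain real linearity.\<close>

definition Sp :: "('v::complex_hilbert_space \<Rightarrow> 'v) set" where
  "Sp = {g. linear g \<and> bij g \<and> (\<forall>x y. symp_form (g x) (g y) = symp_form x y)}"

definition fock_implementer ::
    "('v::complex_hilbert_space \<Rightarrow> 'v) \<Rightarrow> ('v sym_alg \<Rightarrow> 'v sym_antidual) \<Rightarrow> bool" where
  "fock_implementer g U \<longleftrightarrow>
     clinear U \<and> U \<noteq> (\<lambda>_. 0) \<and> (\<forall>v \<psi>. U (pi_sym v \<psi>) = pi_dual (g v) (U \<psi>))"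

definition fock_vacuum ::
    "('v::complex_hilbert_space \<Rightarrow> 'v) \<Rightarrow> 'v sym_antidual \<Rightarrow> bool" where
  "fock_vacuum g \<Phi> \<longleftrightarrow>
     \<Phi> \<noteq> 0 \<and> (\<forall>v. pi_dual (g v) \<Phi> + \<i> *\<^sub>C pi_dual (g (\<i> *\<^sub>C v)) \<Phi> = 0)"

end

theory Submission
  imports Defs
begin

text \<open>
  Write \<open>\<pi>\<close> for the field operators. On \<open>SV\<close> the creators and annihilators are recovered from them as
  \<open>c(v) = (\<pi>(v) - i \<pi>(iv)) / \<surd>2\<close> and \<open>a(v) = (\<pi>(v) + i \<pi>(iv)) / \<surd>2\<close>. Replacing \<open>\<pi>(v)\<close> by
  \<open>\<pi>(gv)\<close>, now acting on the antidual \<open>SV'\<close>, gives transported operators \<open>C(v)\<close> and \<open>A(v)\<close>, and a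
  linear map \<open>U\<close> intertwines the fields exactly when it intertwines \<open>c\<close> with \<open>C\<close> and \<open>a\<close> with \<open>A\<close>
  (lemma \<open>intertwines_fields_iff\<close>). A generalized Fock vacuum is a nonzero vector killed by all
  \<open>A(v)\<close>.

  If \<open>U\<close> is an implementer, then \<open>U(v\<^sub>1 \<cdots> v\<^sub>n) = C(v\<^sub>1) \<cdots> C(v\<^sub>n) U(1)\<close>. Hence \<open>U\<close> is determined by
  \<open>U(1)\<close>, which is therefore nonzero, and \<open>A(v) U(1) = U(a(v) 1) = 0\<close> makes \<open>U(1)\<close> a vacuum.

  Conversely, let \<open>\<Phi>\<close> be a vacuum. The fields satisfy \<open>[\<pi>(v), \<pi>(w)] = i \<Omega>(v, w)\<close> on \<open>SV\<close> and also
  on \<open>SV'\<close>: a field acts on \<open>SV'\<close> by precomposition, which reverses the order of products, but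
  antilinearity conjugates the scalar \<open>i\<close>, and the two signs cancel. As \<open>g\<close> is real linear and
  preserves \<open>\<Omega>\<close>, the operators \<open>C(v)\<close> are complex linear in \<open>v\<close> and commute, and
  \<open>[A(v), C(w)] = \<langle>v|w\<rangle>\<close>. By the first two properties the universal property of the symmetric
  algebra (lemma \<open>sym_alg_action_exists\<close>) provides a linear \<open>U\<close> with \<open>U(1) = \<Phi>\<close> and
  \<open>U c(v) = C(v) U\<close>. By the third, \<open>A(v)\<close> passes through products of \<open>C\<close>'s as a derivation, just
  as \<open>a(v)\<close> does, and both kill the starting vector; so \<open>U a(v) = A(v) U\<close> and \<open>U\<close> is an implementer.
\<close>


section \<open>Modules over the symmetric algebra from commuting operators\<close>

lemma clinear_zero: "clinear f \<Longrightarrow> f 0 = 0"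
  by (metis clinear_iff add_cancel_right_right)

lemma clinear_diff: "clinear f \<Longrightarrow> f (x - y) = f x - f y"
  by (metis clinear_iff add_diff_cancel diff_add_cancel)

definition free_extend :: "('v multiset \<Rightarrow> 'w::complex_vector) \<Rightarrow> 'v free_alg \<Rightarrow> 'w" where
  "free_extend f p = (\<Sum>M\<in>Poly_Mapping.keys p. Poly_Mapping.lookup p M *\<^sub>C f M)"

lemma free_extend_superset:
  assumes "finite S" "Poly_Mapping.keys p \<subseteq> S"
  shows "free_extend f p = (\<Sum>M\<in>S. Poly_Mapping.lookup p M *\<^sub>C f M)"
  unfolding free_extend_def using assms
  by (intro sum.mono_neutral_left) (auto simp: in_keys_iff)

lemma free_extend_zero: "free_extend f 0 = 0"
  by (simp add: free_extend_def)

lemma free_extend_add: "free_extend f (p + q) = free_extend f p + free_extend f q"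
proof -
  let ?S = "Poly_Mapping.keys p \<union> Poly_Mapping.keys q"
  have "Poly_Mapping.keys (p + q) \<subseteq> ?S" by (rule Poly_Mapping.keys_add)
  then show ?thesis
    by (simp add: free_extend_superset[of ?S] lookup_add scaleC_add_left sum.distrib)
qed

lemma free_extend_diff: "free_extend f (p - q) = free_extend f p - free_extend f q"
  using free_extend_add[of f "p - q" q] by simp

lemma free_extend_single: "free_extend f (Poly_Mapping.single M c) = c *\<^sub>C f M"
  by (subst free_extend_superset[of "{M}"]) auto

lemma free_extend_scale:
  "free_extend f (Poly_Mapping.single 0 c * p) = c *\<^sub>C free_extend f p"
proof -
  have "Poly_Mapping.keys (Poly_Mapping.single 0 c * p) \<subseteq> Poly_Mapping.keys p"
    by (auto simp: in_keys_iff lookup_scalar_mult)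
  then show ?thesis
    by (simp add: free_extend_superset[of "Poly_Mapping.keys p"] lookup_scalar_mult
        complex_vector.scale_sum_right)
qed

lemma free_extend_gen_mult:
  assumes "clinear T" and f: "\<And>M. f (add_mset v M) = T (f M)"
  shows "free_extend f (free_gen v * p) = T (free_extend f p)"
proof (induction p rule: update_induct)
  case const
  have "T 0 = 0" using assms(1) by (rule clinear_zero)
  then show ?case by (simp add: free_extend_zero)
next
  case (update p M c)
  have upd: "Poly_Mapping.update M c p = p + Poly_Mapping.single M c"
    using update(1)
    by (intro poly_mapping_eqI)
      (auto simp: lookup_update lookup_add lookup_single when_def in_keys_iff)
  have "free_extend f (free_gen v * Poly_Mapping.single M c) =
      T (free_extend f (Poly_Mapping.single M c))"
    using assms by (simp add: free_gen_def mult_single free_extend_single clinear_iff)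
  with update(3) \<open>clinear T\<close> show ?case
    by (simp add: upd free_extend_add distrib_left clinear_iff)
qed

text \<open>This is the universal property of the symmetric algebra for the commutative algebra that
  the operators \<open>C v\<close> generate, composed with evaluation at \<open>\<Phi>\<close>: commutativity makes the monomials
  act, and linearity in \<open>v\<close> kills the ideal of relations.\<close>

lemma sym_alg_action_exists:
  fixes C :: "'v::complex_vector \<Rightarrow> 'w::complex_vector \<Rightarrow> 'w" and \<Phi> :: 'w
  assumes lin: "\<And>v. clinear (C v)"
    and add: "\<And>v w x. C (v + w) x = C v x + C w x"
    and scale: "\<And>c v x. C (c *\<^sub>C v) x = c *\<^sub>C C v x"
    and commute: "\<And>v w x. C v (C w x) = C w (C v x)"
  obtains U where "clinear U" "U 1 = \<Phi>" "\<And>v x. U (sym_gen v * x) = C v (U x)"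
proof -
  interpret comp_fun_commute C
    by standard (simp add: fun_eq_iff commute)
  define F where "F = free_extend (fold_mset C \<Phi>)"
  have F_gen: "F (free_gen v * p) = C v (F p)" for v p
    unfolding F_def by (rule free_extend_gen_mult[OF lin]) (simp add: fold_mset_add_mset)
  have F_ideal: "F p = 0" if "p \<in> sym_ideal" for p
    using that unfolding sym_ideal_def
  proof (induction rule: free_mod.span_induct_alt)
    case base
    then show ?case by (simp add: F_def free_extend_zero)
  next
    case (step q r p)
    from step(1) consider
        v w where "r = free_gen (v + w) - free_gen v - free_gen w"
      | c v where "r = free_gen (c *\<^sub>C v) - Poly_Mapping.single 0 c * free_gen v"
      unfolding sym_rels_def by blast
    then have "F (r * q) = 0"
    proof cases
      case 1
      then have "r * q = free_gen (v + w) * q - free_gen v * q - free_gen w * q"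
        by (simp add: left_diff_distrib)
      then have "F (r * q) = F (free_gen (v + w) * q) - F (free_gen v * q) - F (free_gen w * q)"
        by (simp add: F_def free_extend_diff)
      then show ?thesis by (simp add: F_gen add)
    next
      case 2
      then have "r * q = free_gen (c *\<^sub>C v) * q - Poly_Mapping.single 0 c * (free_gen v * q)"
        by (simp only: left_diff_distrib mult.assoc[of "Poly_Mapping.single 0 c" "free_gen v" q])
      then have "F (r * q) = F (free_gen (c *\<^sub>C v) * q) - c *\<^sub>C F (free_gen v * q)"
        by (simp only: F_def free_extend_diff free_extend_scale)
      then show ?thesis by (simp add: F_gen scale)
    qed
    then have "F (q * r) = 0"
      by (simp only: mult.commute[of q r])
    then show ?case
      using step(2) by (simp add: F_def free_extend_add)
  qed
  define U where "U = (\<lambda>x. F (rep_sym_alg x))"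
  have U: "U (abs_sym_alg p) = F p" for p
  proof -
    have "abs_sym_alg (rep_sym_alg (abs_sym_alg p)) = abs_sym_alg p"
      by (rule Quotient_abs_rep[OF Quotient_sym_alg])
    then have "F (rep_sym_alg (abs_sym_alg p) - p) = 0"
      by (simp add: abs_sym_alg_eq_iff F_ideal)
    then show ?thesis by (simp add: U_def F_def free_extend_diff)
  qed
  have ex: "\<exists>p. x = abs_sym_alg p" for x :: "'v sym_alg"
    by (metis Quotient_abs_rep[OF Quotient_sym_alg])
  have "U (x + y) = U x + U y" for x y
    using ex[of x] ex[of y] by (auto simp: plus_sym_alg.abs_eq U F_def free_extend_add)
  moreover have "U (c *\<^sub>C x) = c *\<^sub>C U x" for c x
    using ex[of x] by (auto simp: scaleC_sym_alg.abs_eq U F_def free_extend_scale)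
  ultimately have "clinear U" by (simp add: clinear_iff)
  moreover have "U 1 = \<Phi>"
    using free_extend_single[of "fold_mset C \<Phi>" 0 1]
    by (simp add: one_sym_alg_def U F_def scaleC_one)
  moreover have "U (sym_gen v * x) = C v (U x)" for v x
    using ex[of x] by (auto simp: sym_gen.abs_eq times_sym_alg.abs_eq U F_gen)
  ultimately show thesis by (rule that)
qed

text \<open>Uniqueness in the universal property: \<open>1\<close> generates the symmetric algebra under
  multiplication by vectors.\<close>

lemma clinear_eqI_sym_alg:
  assumes "clinear U" "clinear U'" "U 1 = U' 1"
    and "\<And>v x. U (sym_gen v * x) = C v (U x)" "\<And>v x. U' (sym_gen v * x) = C v (U' x)"
  shows "U = U'"
proof
  fix x show "U x = U' x"
    by (induction x rule: sym_alg_induct) (use assms in \<open>auto simp: clinear_iff\<close>)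
qed


section \<open>Canonical commutation relations\<close>

lemma cinner_add_left: "cinner (x + y) z = cinner x z + cinner y z"
  for x :: "'v::complex_hilbert_space"
  by (metis cinner_add_right cinner_commute complex_cnj_add)

lemma cinner_scaleC_left: "cinner (c *\<^sub>C x) y = cnj c * cinner x y"
  for x :: "'v::complex_hilbert_space"
  by (metis cinner_commute cinner_scaleC_right complex_cnj_mult)

lemma annih_sym_gen_mult:
  "annih_sym v (sym_gen w * x) = cinner v w *\<^sub>C x + sym_gen w * annih_sym v x"
  by (simp add: annih_sym_mult annih_sym_gen scaleC_mult_left)

lemma annih_sym_zero: "annih_sym v 0 = 0"
  using annih_sym_scaleC[of v 0 0] by simp

lemma annih_sym_add_index: "annih_sym (v + w) x = annih_sym v x + annih_sym w x"
  by (induction x rule: sym_alg_induct)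
    (simp_all add: annih_sym_one annih_sym_gen_mult annih_sym_add annih_sym_scaleC
      cinner_add_left scaleC_add_left scaleC_add_right distrib_left)

lemma annih_sym_scaleC_index: "annih_sym (c *\<^sub>C v) x = cnj c *\<^sub>C annih_sym v x"
  by (induction x rule: sym_alg_induct)
    (simp_all add: annih_sym_one annih_sym_gen_mult annih_sym_add annih_sym_scaleC
      cinner_scaleC_left scaleC_add_right scaleC_scaleC scaleC_mult_right mult.commute[of c]
      mult.commute[of "cnj c"])

lemma annih_sym_commute: "annih_sym v (annih_sym w x) = annih_sym w (annih_sym v x)"
  by (induction x rule: sym_alg_induct)
    (simp_all add: annih_sym_one annih_sym_gen_mult annih_sym_add annih_sym_scaleC annih_sym_zero
      add_ac)

lemma pi_sym_eq:
  "pi_sym v x = complex_of_real (1 / sqrt 2) *\<^sub>C (sym_gen v * x + annih_sym v x)"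
  by (simp add: pi_sym_def creat_sym_def scaleR_scaleC)

lemma pi_sym_add_index: "pi_sym (v + w) x = pi_sym v x + pi_sym w x"
  by (simp add: pi_sym_eq annih_sym_add_index sym_gen_add distrib_right scaleC_add_right)

lemma pi_sym_scaleR_index: "pi_sym (r *\<^sub>R v) x = complex_of_real r *\<^sub>C pi_sym v x"
  by (simp add: pi_sym_eq scaleR_scaleC annih_sym_scaleC_index sym_gen_scaleC scaleC_mult_left
      scaleC_mult_right scaleC_add_right scaleC_scaleC mult.commute[of "complex_of_real r"])

lemma inv_sqrt2_mult_self: "complex_of_real (1 / sqrt 2) * complex_of_real (1 / sqrt 2) = 1 / 2"
  by (simp flip: of_real_mult)

lemma pi_sym_commutator:
  "pi_sym v (pi_sym w x) = pi_sym w (pi_sym v x) + (\<i> * complex_of_real (symp_form v w)) *\<^sub>C x"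
proof -
  have expand: "pi_sym v (pi_sym w x) = (1 / 2) *\<^sub>C
      (sym_gen v * sym_gen w * x + sym_gen v * annih_sym w x + sym_gen w * annih_sym v x
        + annih_sym v (annih_sym w x) + cinner v w *\<^sub>C x)" for v w
    unfolding pi_sym_eq
    by (simp only: annih_sym_add annih_sym_scaleC annih_sym_gen_mult scaleC_mult_right
        scaleC_add_right[symmetric] scaleC_scaleC inv_sqrt2_mult_self)
      (simp add: algebra_simps)
  have "cinner v w - cinner w v = 2 * (\<i> * complex_of_real (symp_form v w))"
    using cinner_commute[of w v]
    by (simp add: symp_form_def complex_eq_iff)
  then have form: "cinner v w = cinner w v + 2 * (\<i> * complex_of_real (symp_form v w))"
    by (simp add: algebra_simps)
  have half: "(1 / 2) *\<^sub>C (y + (q + 2 * t) *\<^sub>C x) = (1 / 2) *\<^sub>C (y + q *\<^sub>C x) + t *\<^sub>C x" for y q t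
    by (simp add: scaleC_add_right scaleC_add_left scaleC_scaleC)
  show ?thesis
    unfolding expand[of v w] expand[of w v] form half
    by (simp add: annih_sym_commute[of v w] mult.commute[of "sym_gen v"] add_ac)
qed

lemma antidual_eqI: "(\<And>x. antidual_apply \<Phi> x = antidual_apply \<Psi> x) \<Longrightarrow> \<Phi> = \<Psi>"
  by (simp add: antidual_apply_inject[symmetric] fun_eq_iff)

lemmas antidual_apply_simps =
  plus_sym_antidual.rep_eq minus_sym_antidual.rep_eq scaleC_sym_antidual.rep_eq
  scaleR_sym_antidual.rep_eq zero_sym_antidual.rep_eq uminus_sym_antidual.rep_eq

lemma antidual_apply_add: "antidual_apply \<Phi> (x + y) = antidual_apply \<Phi> x + antidual_apply \<Phi> y"
  and antidual_apply_scaleC: "antidual_apply \<Phi> (c *\<^sub>C x) = cnj c * antidual_apply \<Phi> x"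
  using antidual_apply[of \<Phi>] by (auto simp: antilinear_def)

lemma antidual_apply_pi_dual: "antidual_apply (pi_dual v \<Phi>) x = antidual_apply \<Phi> (pi_sym v x)"
  by (simp add: pi_dual_def pi_sym_def antidual_apply_simps antidual_apply_add
      antidual_apply_scaleC scaleR_scaleC creat_dual.rep_eq annih_dual.rep_eq algebra_simps)

lemma pi_dual_add: "pi_dual v (\<Phi> + \<Psi>) = pi_dual v \<Phi> + pi_dual v \<Psi>"
  and pi_dual_diff: "pi_dual v (\<Phi> - \<Psi>) = pi_dual v \<Phi> - pi_dual v \<Psi>"
  and pi_dual_scaleC: "pi_dual v (c *\<^sub>C \<Phi>) = c *\<^sub>C pi_dual v \<Phi>"
  by (rule antidual_eqI; simp add: antidual_apply_pi_dual antidual_apply_simps)+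

lemma pi_dual_add_index: "pi_dual (v + w) \<Phi> = pi_dual v \<Phi> + pi_dual w \<Phi>"
  and pi_dual_scaleR_index: "pi_dual (r *\<^sub>R v) \<Phi> = complex_of_real r *\<^sub>C pi_dual v \<Phi>"
  by (rule antidual_eqI; simp add: antidual_apply_pi_dual antidual_apply_simps pi_sym_add_index
      pi_sym_scaleR_index antidual_apply_add antidual_apply_scaleC)+

text \<open>The sign agrees with that on \<open>SV\<close>: reversing the order of the two fields under \<open>\<Phi>\<close> changes
  it once, and pulling \<open>i\<close> out of the antilinear \<open>\<Phi>\<close> changes it back.\<close>

lemma pi_dual_commutator:
  "pi_dual v (pi_dual w \<Phi>) =
     pi_dual w (pi_dual v \<Phi>) + (\<i> * complex_of_real (symp_form v w)) *\<^sub>C \<Phi>"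
  by (rule antidual_eqI)
    (simp add: antidual_apply_pi_dual antidual_apply_simps pi_sym_commutator[of v w]
      antidual_apply_add antidual_apply_scaleC)


section \<open>Transported creators and annihilators\<close>

definition transported_creat ::
    "('v::complex_hilbert_space \<Rightarrow> 'v) \<Rightarrow> 'v \<Rightarrow> 'v sym_antidual \<Rightarrow> 'v sym_antidual" where
  "transported_creat g v \<Phi> =
     complex_of_real (1 / sqrt 2) *\<^sub>C (pi_dual (g v) \<Phi> - \<i> *\<^sub>C pi_dual (g (\<i> *\<^sub>C v)) \<Phi>)"

definition transported_annih ::
    "('v::complex_hilbert_space \<Rightarrow> 'v) \<Rightarrow> 'v \<Rightarrow> 'v sym_antidual \<Rightarrow> 'v sym_antidual" where
  "transported_annih g v \<Phi> =
     complex_of_real (1 / sqrt 2) *\<^sub>C (pi_dual (g v) \<Phi> + \<i> *\<^sub>C pi_dual (g (\<i> *\<^sub>C v)) \<Phi>)"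

lemma clinear_transported_creat: "clinear (transported_creat g v)"
  and clinear_transported_annih: "clinear (transported_annih g v)"
  unfolding clinear_iff
  by (auto intro!: antidual_eqI simp: transported_creat_def transported_annih_def
      antidual_apply_simps pi_dual_add pi_dual_scaleC algebra_simps)

lemma pi_dual_eq_transported:
  "pi_dual (g v) \<Phi> =
     complex_of_real (1 / sqrt 2) *\<^sub>C (transported_creat g v \<Phi> + transported_annih g v \<Phi>)"
proof -
  have "transported_creat g v \<Phi> + transported_annih g v \<Phi> =
      complex_of_real (1 / sqrt 2) *\<^sub>C (2 *\<^sub>C pi_dual (g v) \<Phi>)"
    by (rule antidual_eqI)
      (simp add: transported_creat_def transported_annih_def antidual_apply_simps algebra_simps)
  moreover have "complex_of_real (1 / sqrt 2) * (complex_of_real (1 / sqrt 2) * 2) = 1"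
    by (simp only: mult.assoc[symmetric] inv_sqrt2_mult_self) simp
  ultimately show ?thesis
    by (simp only: scaleC_scaleC scaleC_one)
qed

lemma fock_vacuum_iff:
  "fock_vacuum g \<Phi> \<longleftrightarrow> \<Phi> \<noteq> 0 \<and> (\<forall>v. transported_annih g v \<Phi> = 0)"
  by (simp add: fock_vacuum_def transported_annih_def)

lemma sym_gen_mult_eq_pi_sym:
  "sym_gen v * x = complex_of_real (1 / sqrt 2) *\<^sub>C (pi_sym v x - \<i> *\<^sub>C pi_sym (\<i> *\<^sub>C v) x)"
  and annih_sym_eq_pi_sym:
  "annih_sym v x = complex_of_real (1 / sqrt 2) *\<^sub>C (pi_sym v x + \<i> *\<^sub>C pi_sym (\<i> *\<^sub>C v) x)"
proof -
  let ?s = "complex_of_real (1 / sqrt 2)"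
  have i: "\<i> *\<^sub>C pi_sym (\<i> *\<^sub>C v) x = ?s *\<^sub>C (annih_sym v x - sym_gen v * x)"
    by (simp add: pi_sym_eq sym_gen_scaleC annih_sym_scaleC_index scaleC_mult_left
        scaleC_add_right scaleC_scaleC mult.left_commute[of \<i>]
        complex_vector.scale_right_diff_distrib)
  have half: "?s *\<^sub>C ?s *\<^sub>C (y + y) = y" for y :: "'a sym_alg"
  proof -
    have "?s *\<^sub>C ?s *\<^sub>C (y + y) = (1 / 2) *\<^sub>C (y + y)"
      by (simp only: scaleC_scaleC inv_sqrt2_mult_self)
    also have "\<dots> = (1 / 2 + 1 / 2) *\<^sub>C y"
      by (simp only: scaleC_add_right scaleC_add_left)
    finally show ?thesis by (simp add: scaleC_one)
  qed
  have "pi_sym v x - \<i> *\<^sub>C pi_sym (\<i> *\<^sub>C v) x = ?s *\<^sub>C (sym_gen v * x + sym_gen v * x)"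
    unfolding i by (simp add: pi_sym_eq flip: complex_vector.scale_right_diff_distrib)
  then show "sym_gen v * x = ?s *\<^sub>C (pi_sym v x - \<i> *\<^sub>C pi_sym (\<i> *\<^sub>C v) x)"
    by (simp only: half)
  have "pi_sym v x + \<i> *\<^sub>C pi_sym (\<i> *\<^sub>C v) x = ?s *\<^sub>C (annih_sym v x + annih_sym v x)"
    unfolding i by (simp add: pi_sym_eq flip: scaleC_add_right)
  then show "annih_sym v x = ?s *\<^sub>C (pi_sym v x + \<i> *\<^sub>C pi_sym (\<i> *\<^sub>C v) x)"
    by (simp only: half)
qed

lemma intertwines_fields_iff:
  assumes "clinear U"
  shows "(\<forall>v x. U (pi_sym v x) = pi_dual (g v) (U x)) \<longleftrightarrow>
    (\<forall>v x. U (sym_gen v * x) = transported_creat g v (U x)) \<and>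
    (\<forall>v x. U (annih_sym v x) = transported_annih g v (U x))"
proof -
  have U: "U (x + y) = U x + U y" "U (x - y) = U x - U y" "U (c *\<^sub>C x) = c *\<^sub>C U x" for x y c
    using assms by (simp_all add: clinear_iff clinear_diff[OF assms])
  show ?thesis
  proof (intro iffI conjI allI; (elim conjE)?)
    fix v x assume *: "\<forall>v x. U (pi_sym v x) = pi_dual (g v) (U x)"
    show "U (sym_gen v * x) = transported_creat g v (U x)"
      by (simp only: sym_gen_mult_eq_pi_sym U * transported_creat_def)
    show "U (annih_sym v x) = transported_annih g v (U x)"
      by (simp only: annih_sym_eq_pi_sym U * transported_annih_def)
  next
    fix v x
    assume "\<forall>v x. U (sym_gen v * x) = transported_creat g v (U x)"
      and "\<forall>v x. U (annih_sym v x) = transported_annih g v (U x)"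
    then show "U (pi_sym v x) = pi_dual (g v) (U x)"
      by (simp only: pi_sym_eq pi_dual_eq_transported U)
  qed
qed

lemma fock_implementer_iff:
  "fock_implementer g U \<longleftrightarrow> clinear U \<and> U \<noteq> (\<lambda>_. 0) \<and>
    (\<forall>v x. U (sym_gen v * x) = transported_creat g v (U x)) \<and>
    (\<forall>v x. U (annih_sym v x) = transported_annih g v (U x))"
  unfolding fock_implementer_def using intertwines_fields_iff by blast

text \<open>That \<open>U(1)\<close> is nonzero needs an argument: as \<open>1\<close> generates \<open>SV\<close> under the creators,
  \<open>U(1) = 0\<close> would make \<open>U\<close> agree with the zero map.\<close>

lemma fock_vacuum_of_implementer:
  assumes "fock_implementer g U"
  shows "fock_vacuum g (U 1)"
proof -
  from assms have lin: "clinear U" and "U \<noteq> (\<lambda>_. 0)"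
    and creat: "\<And>v x. U (sym_gen v * x) = transported_creat g v (U x)"
    and annih: "\<And>v x. U (annih_sym v x) = transported_annih g v (U x)"
    by (auto simp: fock_implementer_iff)
  have "transported_creat g v 0 = 0" for v
    using clinear_transported_creat by (rule clinear_zero)
  then have "U = (\<lambda>_. 0)" if "U 1 = 0"
    using that lin creat
    by (intro clinear_eqI_sym_alg[where C = "transported_creat g"]) (simp_all add: clinear_iff)
  with \<open>U \<noteq> (\<lambda>_. 0)\<close> have "U 1 \<noteq> 0" by blast
  moreover have "transported_annih g v (U 1) = 0" for v
    using annih[of v 1] clinear_zero[OF lin] by (simp add: annih_sym_one)
  ultimately show ?thesis by (simp add: fock_vacuum_iff)
qed

context
  fixes g :: "'v::complex_hilbert_space \<Rightarrow> 'v"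
  assumes Sp: "g \<in> Sp"
begin

lemma Sp_add: "g (v + w) = g v + g w"
  and Sp_scaleR: "g (r *\<^sub>R v) = r *\<^sub>R g v"
  and Sp_symp_form: "symp_form (g v) (g w) = symp_form v w"
  using Sp by (auto simp: Sp_def linear_iff)

lemma transported_creat_add_index:
  "transported_creat g (v + w) \<Phi> = transported_creat g v \<Phi> + transported_creat g w \<Phi>"
  by (rule antidual_eqI)
    (simp add: transported_creat_def Sp_add pi_dual_add_index scaleC_add_right
      antidual_apply_simps algebra_simps)

text \<open>Although \<open>g\<close> is only real linear, \<open>C(v)\<close> is complex linear in \<open>v\<close>: substituting \<open>iv\<close> for \<open>v\<close>
  merely exchanges its two terms, up to the factor \<open>i\<close>.\<close>

lemma transported_creat_scaleC_index:
  "transported_creat g (c *\<^sub>C v) \<Phi> = c *\<^sub>C transported_creat g v \<Phi>"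
proof -
  have "c *\<^sub>C v = Re c *\<^sub>R v + Im c *\<^sub>R (\<i> *\<^sub>C v)"
    by (simp add: scaleR_scaleC scaleC_scaleC complex_eq mult.commute flip: scaleC_add_left)
  moreover have "transported_creat g (r *\<^sub>R v) \<Phi> = complex_of_real r *\<^sub>C transported_creat g v \<Phi>"
    for r v
  proof -
    have "\<i> *\<^sub>C (r *\<^sub>R v) = r *\<^sub>R (\<i> *\<^sub>C v)"
      by (simp add: scaleR_scaleC scaleC_scaleC mult.commute)
    then show ?thesis
      by (intro antidual_eqI)
        (simp add: transported_creat_def Sp_scaleR pi_dual_scaleR_index antidual_apply_simps
          algebra_simps)
  qed
  moreover have "transported_creat g (\<i> *\<^sub>C v) \<Phi> = \<i> *\<^sub>C transported_creat g v \<Phi>"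
  proof -
    have "\<i> *\<^sub>C (\<i> *\<^sub>C v) = (- 1) *\<^sub>R v"
      by (simp add: scaleR_scaleC scaleC_scaleC)
    then have "pi_dual (g (\<i> *\<^sub>C (\<i> *\<^sub>C v))) \<Phi> = (- 1) *\<^sub>C pi_dual (g v) \<Phi>"
      by (simp only: Sp_scaleR pi_dual_scaleR_index of_real_minus of_real_1)
    then show ?thesis
      by (intro antidual_eqI)
        (simp add: transported_creat_def antidual_apply_simps algebra_simps)
  qed
  ultimately have "transported_creat g (c *\<^sub>C v) \<Phi> =
      (complex_of_real (Re c) + complex_of_real (Im c) * \<i>) *\<^sub>C transported_creat g v \<Phi>"
    by (simp add: transported_creat_add_index scaleC_scaleC scaleC_add_left)
  then show ?thesis by (simp add: complex_eq[of c, symmetric] mult.commute)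
qed

lemma transported_field_commutator:
  "pi_dual (g v) (pi_dual (g w) \<Phi>) =
     pi_dual (g w) (pi_dual (g v) \<Phi>) + (\<i> * complex_of_real (symp_form v w)) *\<^sub>C \<Phi>"
  using pi_dual_commutator[of "g v" "g w"] by (simp add: Sp_symp_form)

text \<open>The four field commutators contribute \<open>\<Omega>(v, iw) + \<Omega>(iv, w)\<close> and \<open>\<Omega>(v, w) - \<Omega>(iv, iw)\<close>, which
  vanish because \<open>\<Omega>\<close> is the imaginary part of a sesquilinear form.\<close>

lemma transported_creat_commute:
  "transported_creat g v (transported_creat g w \<Phi>) = transported_creat g w (transported_creat g v \<Phi>)"
  by (rule antidual_eqI)
    (simp add: transported_creat_def pi_dual_diff pi_dual_scaleC antidual_apply_simps
      transported_field_commutator[of v] transported_field_commutator[of "\<i> *\<^sub>C v"]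
      symp_form_def cinner_scaleC_left cinner_scaleC_right algebra_simps)

text \<open>With the opposite sign in front of \<open>i \<pi>(g(iv))\<close> the four contributions add up instead of
  cancelling, and recover \<open>\<langle>v|w\<rangle>\<close> from its imaginary part.\<close>

lemma transported_annih_creat:
  "transported_annih g v (transported_creat g w \<Phi>) =
     cinner v w *\<^sub>C \<Phi> + transported_creat g w (transported_annih g v \<Phi>)"
proof -
  define D where "D = antidual_apply (transported_annih g v (transported_creat g w \<Phi>))"
  define E where "E = antidual_apply (transported_creat g w (transported_annih g v \<Phi>))"
  have form: "\<i> * complex_of_real (symp_form v w) + complex_of_real (symp_form v (\<i> *\<^sub>C w))
      - complex_of_real (symp_form (\<i> *\<^sub>C v) w) + \<i> * complex_of_real (symp_form (\<i> *\<^sub>C v) (\<i> *\<^sub>C w))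
      = 2 * cinner v w"
    by (simp add: symp_form_def cinner_scaleC_left cinner_scaleC_right complex_eq_iff)
  have "D x = E x + complex_of_real (1 / sqrt 2) * complex_of_real (1 / sqrt 2) *
      (\<i> * complex_of_real (symp_form v w) + complex_of_real (symp_form v (\<i> *\<^sub>C w))
      - complex_of_real (symp_form (\<i> *\<^sub>C v) w)
      + \<i> * complex_of_real (symp_form (\<i> *\<^sub>C v) (\<i> *\<^sub>C w))) * antidual_apply \<Phi> x" for x
    unfolding D_def E_def
    by (simp add: transported_annih_def transported_creat_def pi_dual_add pi_dual_diff
        pi_dual_scaleC antidual_apply_simps transported_field_commutator[of v]
        transported_field_commutator[of "\<i> *\<^sub>C v"] algebra_simps)
  then show ?thesis
    unfolding form inv_sqrt2_mult_self
    by (intro antidual_eqI) (simp add: D_def E_def antidual_apply_simps)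
qed

text \<open>The intertwining of annihilators is inherited from that of creators by induction over
  products: \<open>a(v)\<close> and \<open>A(v)\<close> obey the same commutation rule with creators, and both kill the
  starting vector.\<close>

lemma implementer_of_fock_vacuum:
  assumes "fock_vacuum g \<Phi>"
  shows "\<exists>U. fock_implementer g U \<and> U 1 = \<Phi>"
proof -
  from assms have "\<Phi> \<noteq> 0" and vac: "\<And>v. transported_annih g v \<Phi> = 0"
    by (auto simp: fock_vacuum_iff)
  obtain U where lin: "clinear U" and one: "U 1 = \<Phi>"
    and creat: "\<And>v x. U (sym_gen v * x) = transported_creat g v (U x)"
    using sym_alg_action_exists[of "transported_creat g" \<Phi>, OF clinear_transported_creat
        transported_creat_add_index transported_creat_scaleC_index transported_creat_commute]
    by blast
  have U: "U (x + y) = U x + U y" "U (c *\<^sub>C x) = c *\<^sub>C U x" for x y c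
    using lin by (simp_all add: clinear_iff)
  have A: "transported_annih g v (x + y) = transported_annih g v x + transported_annih g v y"
    "transported_annih g v (c *\<^sub>C x) = c *\<^sub>C transported_annih g v x" for v x y c
    using clinear_transported_annih[of g v] by (simp_all add: clinear_iff)
  have "U (annih_sym v x) = transported_annih g v (U x)" for v x
    by (induction x rule: sym_alg_induct)
      (simp_all add: annih_sym_one one vac annih_sym_gen_mult annih_sym_add annih_sym_scaleC
        creat U A transported_annih_creat clinear_zero[OF lin])
  moreover have "U \<noteq> (\<lambda>_. 0)" using one \<open>\<Phi> \<noteq> 0\<close> by auto
  ultimately show ?thesis
    using lin creat one by (auto simp: fock_implementer_iff)
qed

end

theorem theorem3p8:
  fixes g :: "'v::complex_hilbert_space \<Rightarrow> 'v"
  assumes "g \<in> Sp"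
  shows "bij_betw (\<lambda>U. U 1) {U. fock_implementer g U} {\<Phi>. fock_vacuum g \<Phi>}"
proof (rule bij_betw_imageI)
  show "inj_on (\<lambda>U. U 1) {U. fock_implementer g U}"
    by (rule inj_onI)
      (auto simp: fock_implementer_iff
        intro: clinear_eqI_sym_alg[where C = "transported_creat g"])
  show "(\<lambda>U. U 1) ` {U. fock_implementer g U} = {\<Phi>. fock_vacuum g \<Phi>}"
    using fock_vacuum_of_implementer implementer_of_fock_vacuum[OF assms] by force
qed

end
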